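(* Let $p\ge1$ and $q\ge p$ be integers and let $\alpha_1,\dots,\alpha_p>0$, $\beta_1,\dots,\beta_q>0$. For $a>0$ let $F(a;z)={}_pF_q\Big[\begin{matrix}a,\alpha_2,\dots,\alpha_p\\ \beta_1,\dots,\beta_q\end{matrix}\Big|z\Big]$. Then for all $z\in(0,\infty)$ $$F(\alpha_1;z)\,F(\alpha_1+2;z)-\frac{\alpha_1}{\alpha_1+1}\big(F(\alpha_1+1;z)\big)^2>0.$$
   Context: The generalized hypergeometric function is $${}_pF_q\Big[\begin{matrix}\alpha_1,\dots,\alpha_p\\ \beta_1,\dots,\beta_q\end{matrix}\Big|z\Big]=\sum_{k=0}^\infty\frac{\prod_{l=1}^p(\alpha_l)_k}{\prod_{l=1}^q(\beta_l)_k}\frac{z^k}{k!},$$ where $(\tau)_0=1$ and $(\tau)_k=\tau(\tau+1)\cdots(\tau+k-1)$ for $k\ge1$. *)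

theory Defs imports "HOL-Analysis.FPS_Convergence" begin

text \<open>
  Parameters are indexed as \<open>\<alpha> 1, \<dots>, \<alpha> p\<close> and \<open>\<beta> 1, \<dots>, \<beta> q\<close>; values outside these ranges
  are irrelevant.
\<close>

definition hypergeometric ::
    "nat \<Rightarrow> nat \<Rightarrow> (nat \<Rightarrow> real) \<Rightarrow> (nat \<Rightarrow> real) \<Rightarrow> real \<Rightarrow> real" where
  "hypergeometric p q \<alpha> \<beta> z =
     (\<Sum>k. (\<Prod>l=1..p. pochhammer (\<alpha> l) k) / (\<Prod>l=1..q. pochhammer (\<beta> l) k) * (z ^ k / fact k))"

lemma hypergeometric_eq_eval_fps_hypergeo:
  "hypergeometric p q \<alpha> \<beta> z =
     eval_fps (fps_hypergeo (map \<alpha> [1..<Suc p]) (map \<beta> [1..<Suc q]) 1) z"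
proof -
  have *: "foldl (\<lambda>r a. r * pochhammer a k) 1 (map f [1..<Suc n]) = (\<Prod>l=1..n. pochhammer (f l) k)"
    for f :: "nat \<Rightarrow> real" and n k
    by (induction n) (simp_all add: prod.nat_ivl_Suc')
  show ?thesis
    unfolding hypergeometric_def eval_fps_def fps_hypergeo_nth * by simp
qed

end

theory Submission imports Defs begin

text \<open>
  The factor \<open>(a)\<^sub>k\<close> is the only part of a coefficient that depends on \<open>a\<close>, and
  \<open>(a+1)\<^sub>k = (a)\<^sub>k (a+k)/a\<close>.  Put \<open>w\<^sub>k\<close> for the \<open>k\<close>-th term of \<open>F(a;z)\<close> and \<open>x\<^sub>k = a + k\<close>, both
  positive.  Then \<open>F(a+1;z)\<close> and \<open>F(a+2;z)\<close> are, up to the factors \<open>1/a\<close> and \<open>1/(a(a+1))\<close>,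
  the moments \<open>\<Sum>w\<^sub>k x\<^sub>k\<close> and \<open>\<Sum>w\<^sub>k x\<^sub>k(x\<^sub>k+1)\<close> of one and the same positive sequence.  The claim
  becomes \<open>(\<Sum>w x)\<^sup>2 < (\<Sum>w) (\<Sum>w x(x+1))\<close>.  This is the Cauchy--Schwarz inequality
  \<open>(\<Sum>w x)\<^sup>2 \<le> (\<Sum>w) (\<Sum>w x\<^sup>2)\<close>, made strict by the extra term \<open>(\<Sum>w) (\<Sum>w x) > 0\<close>.
  Conceptually, \<open>\<Gamma>(a) F(a;z)\<close> inherits log-convexity in \<open>a\<close> from \<open>\<Gamma>\<close>, and the inequality
  compares its values at \<open>a\<close>, \<open>a+1\<close> and \<open>a+2\<close>.
  The condition \<open>p \<le> q\<close> makes all the series converge, by the ratio test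
  (\<open>summable_hypergeometric\<close>).
\<close>

text \<open>
  With \<open>t = S1 / S0\<close>, the mean of \<open>x\<close> under the weights \<open>w\<close>, the difference \<open>S0 S2 - S1\<^sup>2\<close>
  equals \<open>S0 \<Sum>w (x - t)\<^sup>2 + S0 S1\<close>: a nonnegative variance term and a positive one.
\<close>

lemma first_moment_squared_less:
  fixes w x :: "nat \<Rightarrow> real"
  assumes s0: "w sums S0" and s1: "(\<lambda>k. w k * x k) sums S1"
    and s2: "(\<lambda>k. w k * (x k * (x k + 1))) sums S2"
    and w: "\<And>k. w k \<ge> 0" and S0: "S0 > 0" and S1: "S1 > 0"
  shows "S1\<^sup>2 < S0 * S2"
proof -
  define t where "t = S1 / S0"
  have expand: "w k * (x k - t)\<^sup>2
      = w k * (x k * (x k + 1)) - w k * x k - 2 * t * (w k * x k) + t\<^sup>2 * w k" for k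
    by (simp add: power2_eq_square algebra_simps)
  have variance: "(\<lambda>k. w k * (x k - t)\<^sup>2) sums (S2 - S1 - 2 * t * S1 + t\<^sup>2 * S0)"
    unfolding expand by (intro sums_add sums_diff sums_mult s0 s1 s2)
  have "0 \<le> S2 - S1 - 2 * t * S1 + t\<^sup>2 * S0"
    by (rule sums_le[OF _ sums_zero variance]) (simp add: w)
  then have "0 \<le> S0 * (S2 - S1 - 2 * t * S1 + t\<^sup>2 * S0)"
    using S0 by simp
  also have "\<dots> = S0 * S2 - S0 * S1 - S1\<^sup>2"
    using S0 by (simp add: t_def power2_eq_square field_simps)
  finally show ?thesis
    using mult_pos_pos[OF S0 S1] by linarith
qed

text \<open>
  Each term arises from its predecessor by multiplication with
  \<open>\<Prod>\<^sub>l\<^sub>\<le>\<^sub>p (\<alpha>\<^sub>l+k)/(\<beta>\<^sub>l+k) \<cdot> \<Prod>\<^sub>p\<^sub><\<^sub>l\<^sub>\<le>\<^sub>q 1/(\<beta>\<^sub>l+k) \<cdot> z/(k+1)\<close>.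
  The first product tends to \<open>1\<close>, the second is bounded and the last factor tends to \<open>0\<close>.
\<close>

lemma summable_hypergeometric:
  fixes \<alpha> \<beta> :: "nat \<Rightarrow> real"
  assumes pq: "p \<le> q" and \<beta>: "\<And>l. l \<in> {1..q} \<Longrightarrow> \<beta> l > 0"
  shows "summable (\<lambda>k. (\<Prod>l=1..p. pochhammer (\<alpha> l) k) / (\<Prod>l=1..q. pochhammer (\<beta> l) k)
           * (z ^ k / fact k))" (is "summable ?f")
proof -
  have quot0: "(\<lambda>k. c / (d + real k)) \<longlonglongrightarrow> 0" for c d :: real
    by (rule real_tendsto_divide_at_top[OF tendsto_const])
       (auto intro!: filterlim_tendsto_add_at_top filterlim_real_sequentially)
  have quot1: "(\<lambda>k. (c + real k) / (d + real k)) \<longlonglongrightarrow> 1" if "d > 0" for c d :: real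
  proof -
    have "(\<lambda>k. 1 + (c - d) / (d + real k)) \<longlonglongrightarrow> 1 + 0"
      by (intro tendsto_intros quot0)
    also have "(\<lambda>k. 1 + (c - d) / (d + real k)) = (\<lambda>k. (c + real k) / (d + real k))"
    proof
      show "1 + (c - d) / (d + real k) = (c + real k) / (d + real k)" for k
        using add_pos_nonneg[OF that of_nat_0_le_iff[of k]] by (simp add: field_simps)
    qed
    finally show ?thesis by simp
  qed
  define r where "r k = (\<Prod>l=1..p. (\<alpha> l + real k) / (\<beta> l + real k))
      * (\<Prod>l=p+1..q. 1 / (\<beta> l + real k)) * (z / (1 + real k))" for k
  have "r \<longlonglongrightarrow> (\<Prod>l=1..p. 1) * (\<Prod>l=p+1..q. 0) * 0"
    unfolding r_def using pq \<beta> by (intro tendsto_intros quot0 quot1) auto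
  then have r: "r \<longlonglongrightarrow> 0" by simp
  have split: "{1..q} = {1..p} \<union> {p+1..q}" using pq by auto
  have prod_q: "(\<Prod>l=1..q. \<beta> l + real k) = (\<Prod>l=1..p. \<beta> l + real k) * (\<Prod>l=p+1..q. \<beta> l + real k)" for k
    unfolding split by (rule prod.union_disjoint) auto
  have step: "?f (Suc k) = r k * ?f k" for k
    by (simp add: r_def pochhammer_Suc prod.distrib prod_dividef prod_q mult_ac del: One_nat_def)
  have "eventually (\<lambda>k. norm (r k) < 1/2) sequentially"
    using tendsto_norm[OF r] by (intro order_tendstoD(2)) auto
  then obtain N where N: "\<And>k. k \<ge> N \<Longrightarrow> norm (r k) < 1/2"
    by (auto simp: eventually_sequentially)
  show ?thesis
  proof (rule summable_ratio_test[of "1/2" N])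
    fix k assume "N \<le> k"
    then show "norm (?f (Suc k)) \<le> 1/2 * norm (?f k)"
      unfolding step norm_mult[of "r k"] using N[of k] by (intro mult_right_mono) auto
  qed simp
qed

lemma pochhammer_shift:
  fixes a :: real
  shows "a * pochhammer (a + 1) k = pochhammer a k * (a + real k)"
  using pochhammer_rec[of a k] pochhammer_Suc[of a k] by simp

theorem corollary1:
  fixes p q :: nat and \<alpha> \<beta> :: "nat \<Rightarrow> real"
  assumes "p \<ge> 1" and "q \<ge> p"
    and "\<And>l. l \<in> {1..p} \<Longrightarrow> \<alpha> l > 0"
    and "\<And>l. l \<in> {1..q} \<Longrightarrow> \<beta> l > 0"
  shows "let F = (\<lambda>a z. hypergeometric p q (\<alpha>(1 := a)) \<beta> z)
         in \<forall>z\<in>{0<..}. F (\<alpha> 1) z * F (\<alpha> 1 + 2) z - \<alpha> 1 / (\<alpha> 1 + 1) * (F (\<alpha> 1 + 1) z)\<^sup>2 > 0"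
  unfolding Let_def
proof
  fix z :: real assume "z \<in> {0<..}"
  then have z: "z > 0" by simp
  define a where "a = \<alpha> 1"
  have a: "a > 0" using assms(1,3) by (simp add: a_def)
  define F where "F b = hypergeometric p q (\<alpha>(1 := b)) \<beta> z" for b
  define c where "c k = (\<Prod>l=2..p. pochhammer (\<alpha> l) k) / (\<Prod>l=1..q. pochhammer (\<beta> l) k)
      * (z ^ k / fact k)" for k
  have c: "c k > 0" for k
    unfolding c_def using assms z
    by (intro mult_pos_pos divide_pos_pos prod_pos pochhammer_pos ballI zero_less_power) auto
  have first: "(\<Prod>l=1..p. pochhammer ((\<alpha>(1 := b)) l) k)
      = pochhammer b k * (\<Prod>l=2..p. pochhammer (\<alpha> l) k)" for b k
    using assms(1) by (subst prod.atLeast_Suc_atMost) (auto intro!: prod.cong simp: numeral_2_eq_2)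
  have F: "(\<lambda>k. pochhammer b k * c k) sums F b" if "b > 0" for b
  proof -
    have "summable (\<lambda>k. (\<Prod>l=1..p. pochhammer ((\<alpha>(1 := b)) l) k) /
        (\<Prod>l=1..q. pochhammer (\<beta> l) k) * (z ^ k / fact k))"
      using assms that by (intro summable_hypergeometric) auto
    from summable_sums[OF this] show ?thesis
      unfolding F_def hypergeometric_def first c_def by (simp add: mult.assoc)
  qed
  have F_pos: "F b > 0" if "b > 0" for b
    using F[OF that] c pochhammer_pos[OF that]
    by (subst sums_unique[OF F[OF that]], intro suminf_pos) (auto simp: sums_iff)
  have s1: "(\<lambda>k. pochhammer a k * c k * (a + real k)) sums (a * F (a + 1))"
    using sums_mult[OF F[of "a + 1"], of a] a
    by (simp add: pochhammer_shift mult.assoc[symmetric]) (simp add: mult_ac)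
  have shift2: "a * (a + 1) * (pochhammer (a + 2) k * c k)
      = pochhammer a k * c k * ((a + real k) * (a + real k + 1))" for k
  proof -
    have "(a + 1) * pochhammer (a + 2) k = pochhammer (a + 1) k * (a + real k + 1)"
      using pochhammer_shift[of "a + 1" k] by (simp add: add_ac)
    with pochhammer_shift[of a k] show ?thesis by algebra
  qed
  have s2: "(\<lambda>k. pochhammer a k * c k * ((a + real k) * (a + real k + 1)))
      sums (a * (a + 1) * F (a + 2))"
    using sums_mult[OF F[of "a + 2"], of "a * (a + 1)"] a unfolding shift2 by simp
  have "(a * F (a + 1))\<^sup>2 < F a * (a * (a + 1) * F (a + 2))"
  proof (rule first_moment_squared_less[OF F[OF a] s1 s2])
    show "0 \<le> pochhammer a k * c k" for k
      using c[of k] pochhammer_pos[OF a, of k] by simp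
  qed (use F_pos a in auto)
  then have "a * (a * (F (a + 1))\<^sup>2) < a * ((a + 1) * (F a * F (a + 2)))"
    by (simp add: power2_eq_square mult_ac)
  then have "a * (F (a + 1))\<^sup>2 < (a + 1) * (F a * F (a + 2))"
    using a by (simp only: mult_less_cancel_left_pos)
  then have "a / (a + 1) * (F (a + 1))\<^sup>2 < F a * F (a + 2)"
    using a by (simp add: pos_divide_less_eq mult.commute)
  then show "0 < hypergeometric p q (\<alpha>(1 := \<alpha> 1)) \<beta> z * hypergeometric p q (\<alpha>(1 := \<alpha> 1 + 2)) \<beta> z
      - \<alpha> 1 / (\<alpha> 1 + 1) * (hypergeometric p q (\<alpha>(1 := \<alpha> 1 + 1)) \<beta> z)\<^sup>2"
    by (simp add: F_def a_def del: fun_upd_triv)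
qed

end
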